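(* Let $G$ be a connected graph on $n$ vertices with chromatic number $\chi$, and let $b_\chi=n+\lceil n/\chi\rceil$. Assume that $G$ contains an independent set $M$ of size $s\ge 2$ such that $N_G(v)=N$ for every $v\in M$, for some fixed set $N\subseteq V(G)\setminus M$. Then the following hold. (a) $\mathcal{D}^{L}(G)$ has an eigenvalue $\lambda_M=\operatorname{Tr}_G(v)+2$ with multiplicity at least $s-1$, for any $v\in M$. (b) $\lambda_M\ge 2n-|N|$. (c) If $|N|\le n-\lceil n/\chi\rceil$, then $\lambda_M\ge b_\chi$, and hence $\mu_G([b_\chi,\partial_1^L(G)])\ge s-1$.
   Context: Graphs are finite, simple and undirected. For a connected graph $G$ with vertices $v_1,\dots,v_n$, let $d_G(u,v)$ be the length of a shortest $u$–$v$ path, $D(G)=(d_G(v_i,v_j))_{i,j}$ the distance matrix, and $\operatorname{Tr}_G(v)=\sum_{u\in V(G)}d_G(u,v)$ the transmission of $v$. The distance Laplacian matrix is $\mathcal{D}^{L}(G)=\operatorname{diag}(\operatorname{Tr}_G(v_1),\dots,\operatorname{Tr}_G(v_n))-D(G)$, a real symmetric positive semidefinite matrix with $\mathcal{D}^{L}(G)\mathbf 1=\mathbf 0$. Its eigenvalues, listed with multiplicity, are ordered $\partial^{L}_1(G)\ge\partial^{L}_2(G)\ge\cdots\ge\partial^{L}_n(G)=0$. For a real interval $I$, $\mu_G(I)$ is the number of eigenvalues of $\mathcal{D}^{L}(G)$ in $I$, counted with multiplicity. $N_G(v)=\{u\in V(G):\{u,v\}\in E(G)\}$ is the open neighborhood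 of $v$. *)

theory Defs
  imports "Graph_Theory.Graph_Theory" "Jordan_Normal_Form.Char_Poly"
begin

text \<open>
  A finite simple undirected graph is a \<open>graph\<close> in the sense of the AFP entry
  Graph_Theory: a finite, loop-free symmetric digraph without parallel arcs. An edge
  between u and v is then a pair of opposite arcs, and adjacency is \<open>u \<rightarrow>\<^bsub>G\<^esub> v\<close>.
\<close>

definition nbhd :: "('a, 'b) pre_digraph \<Rightarrow> 'a \<Rightarrow> 'a set" where
  "nbhd G v = {u \<in> verts G. u \<rightarrow>\<^bsub>G\<^esub> v}"

definition independent_set :: "('a, 'b) pre_digraph \<Rightarrow> 'a set \<Rightarrow> bool" where
  "independent_set G M \<longleftrightarrow> M \<subseteq> verts G \<and> (\<forall>u\<in>M. \<forall>v\<in>M. \<not> u \<rightarrow>\<^bsub>G\<^esub> v)"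

definition proper_colouring :: "('a, 'b) pre_digraph \<Rightarrow> nat \<Rightarrow> ('a \<Rightarrow> nat) \<Rightarrow> bool" where
  "proper_colouring G k c \<longleftrightarrow>
     c ` verts G \<subseteq> {..<k} \<and> (\<forall>u v. u \<rightarrow>\<^bsub>G\<^esub> v \<longrightarrow> c u \<noteq> c v)"

definition chromatic_number :: "('a, 'b) pre_digraph \<Rightarrow> nat" where
  "chromatic_number G = (LEAST k. \<exists>c. proper_colouring G k c)"

text \<open>Only meaningful when v is reachable from u, hence for all vertices of a connected graph.\<close>

definition gdist :: "('a, 'b) pre_digraph \<Rightarrow> 'a \<Rightarrow> 'a \<Rightarrow> nat" where
  "gdist G u v = (LEAST k. \<exists>p. pre_digraph.apath G u p v \<and> length p = k)"

definition transmission :: "('a, 'b) pre_digraph \<Rightarrow> 'a \<Rightarrow> real" where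
  "transmission G v = (\<Sum>u\<in>verts G. real (gdist G u v))"

text \<open>
  The list vs is an enumeration of the vertices without repetition; it fixes the order of
  the rows and columns.
\<close>

definition dist_matrix :: "('a, 'b) pre_digraph \<Rightarrow> 'a list \<Rightarrow> real mat" where
  "dist_matrix G vs =
     mat (length vs) (length vs) (\<lambda>(i, j). real (gdist G (vs ! i) (vs ! j)))"

definition dist_laplacian :: "('a, 'b) pre_digraph \<Rightarrow> 'a list \<Rightarrow> real mat" where
  "dist_laplacian G vs =
     mat_diag (length vs) (\<lambda>i. transmission G (vs ! i)) - dist_matrix G vs"

text \<open>
  The eigenvalues with algebraic multiplicity. The matrix is real symmetric, so its
  characteristic polynomial splits over the reals and no eigenvalue is lost; algebraic and
  geometric multiplicities agree.
\<close>

definition dl_eigenvalues :: "('a, 'b) pre_digraph \<Rightarrow> 'a list \<Rightarrow> real multiset" where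
  "dl_eigenvalues G vs = proots (char_poly (dist_laplacian G vs))"

text \<open>The i-th largest eigenvalue, with i counted from 1.\<close>

definition dl_eigenvalue :: "('a, 'b) pre_digraph \<Rightarrow> 'a list \<Rightarrow> nat \<Rightarrow> real" where
  "dl_eigenvalue G vs i = rev (sorted_list_of_multiset (dl_eigenvalues G vs)) ! (i - 1)"

definition dl_count :: "('a, 'b) pre_digraph \<Rightarrow> 'a list \<Rightarrow> real set \<Rightarrow> nat" where
  "dl_count G vs I = size (filter_mset (\<lambda>x. x \<in> I) (dl_eigenvalues G vs))"

end

theory Submission
  imports Defs
begin

text \<open>
  Vertices of \<open>M\<close> have the same neighbourhood, so they are interchangeable as seen from
  outside: a shortest path ending in \<open>u \<in> M\<close> becomes one ending in \<open>v \<in> M\<close> when its last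
  edge is replaced. Hence all vertices of \<open>M\<close> are equally far from any third vertex, any two
  of them are at distance 2, and they all have the same transmission \<open>t\<close>. It follows that the
  columns of the distance Laplacian at \<open>u\<close> and \<open>v\<close> differ only in the rows of \<open>u\<close> and \<open>v\<close>,
  where the differences are \<open>t + 2\<close> and \<open>-(t + 2)\<close>; in other words \<open>e\<^sub>u - e\<^sub>v\<close> is an eigenvector
  for \<open>t + 2\<close>, and fixing \<open>v\<close> gives \<open>s - 1\<close> independent ones.

  The multiplicity is the algebraic one, so the eigenvectors are not quoted as such. The same
  column differences are taken in the characteristic matrix, where each of the \<open>s - 1\<close> modified
  columns becomes divisible by the linear factor \<open>x - (t + 2)\<close>
  (lemma \<open>linear_power_dvd_char_poly\<close>). This leaves the determinant unchanged.

  For the bound, a vertex of \<open>M\<close> has distance 1 to the vertices of \<open>N\<close> and at least 2 to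
  the other vertices except itself, so \<open>t \<ge> |N| + 2(n - 1 - |N|)\<close>. The last part is this
  inequality combined with the assumed upper bound on \<open>|N|\<close>; the interval then contains all
  copies of \<open>t + 2\<close> because the largest eigenvalue is its right end point.
\<close>

section \<open>Column differences and algebraic multiplicity\<close>

text \<open>
  The hypothesis says \<open>A(e\<^sub>j - e\<^sub>i) = \<lambda>(e\<^sub>j - e\<^sub>i)\<close> for every \<open>j \<in> J\<close>. Working with polynomial
  matrices, the subtraction of column \<open>i\<close> from the columns in \<open>J\<close> is multiplication by
  a unitriangular matrix, and the resulting columns are multiples of \<open>x - \<lambda>\<close>.
  Taking \<open>i\<close> below \<open>J\<close> is what makes the multiplier upper triangular.
\<close>

lemma linear_power_dvd_char_poly:
  fixes A :: "'a :: idom mat"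
  assumes A: "A \<in> carrier_mat n n"
    and i: "i < n" and J: "J \<subseteq> {i<..<n}"
    and diff: "\<And>j k. j \<in> J \<Longrightarrow> k < n \<Longrightarrow>
      A $$ (k, j) - A $$ (k, i) = (if k = j then lam else if k = i then - lam else 0)"
  shows "[:- lam, 1:] ^ card J dvd char_poly A"
proof -
  define C where "C = char_poly_matrix A"
  define P :: "'a poly mat" where
    "P = mat n n (\<lambda>(k, j). if k = j then 1 else if k = i \<and> j \<in> J then - 1 else 0)"
  define Q :: "'a poly mat" where
    "Q = mat n n (\<lambda>(k, j). if j \<in> J then (if k = j then 1 else if k = i then - 1 else 0)
                            else C $$ (k, j))"
  define f :: "nat \<Rightarrow> 'a poly" where "f = (\<lambda>j. if j \<in> J then [:- lam, 1:] else 1)"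
  have C: "C \<in> carrier_mat n n" using A by (simp add: C_def)
  have P: "P \<in> carrier_mat n n" and Q: "Q \<in> carrier_mat n n" by (auto simp: P_def Q_def)
  have Cent: "C $$ (k, j) = (if k = j then [:0, 1:] else 0) + [:- (A $$ (k, j)):]"
    if "k < n" "j < n" for k j
    using that A by (auto simp: C_def char_poly_matrix_def)
  have "C * P = Q * mat_diag n f"
  proof (rule eq_matI)
    fix k j assume "k < dim_row (Q * mat_diag n f)" "j < dim_col (Q * mat_diag n f)"
    then have kj: "k < n" "j < n" using Q mat_diag_dim[of n f] by auto
    have Pent: "P $$ (l, j) = (if l = j then 1 else 0) + (if l = i then (if j \<in> J then - 1 else 0) else 0)"
      if "l < n" for l using that kj J i by (auto simp: P_def)
    have "(C * P) $$ (k, j) = (\<Sum>l = 0..<n. C $$ (k, l) * P $$ (l, j))"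
      using kj C P by (simp add: scalar_prod_def)
    also have "\<dots> = (\<Sum>l = 0..<n. (if l = j then C $$ (k, l) else 0)
        + (if l = i then (if j \<in> J then - C $$ (k, l) else 0) else 0))"
      by (rule sum.cong) (auto simp: Pent)
    also have "\<dots> = C $$ (k, j) + (if j \<in> J then - C $$ (k, i) else 0)"
      using kj i by (simp add: sum.distrib)
    also have "\<dots> = Q $$ (k, j) * f j"
    proof (cases "j \<in> J")
      case True
      then have "i \<noteq> j" using J by auto
      have "A $$ (k, j) = A $$ (k, i) + (if k = j then lam else if k = i then - lam else 0)"
        using diff[OF True kj(1)] by (simp add: algebra_simps)
      then show ?thesis
        using True kj i \<open>i \<noteq> j\<close> by (auto simp: Cent Q_def f_def one_pCons)
    next
      case False
      then show ?thesis using kj by (simp add: Q_def f_def)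
    qed
    also have "\<dots> = (Q * mat_diag n f) $$ (k, j)"
      using kj by (simp add: mat_diag_mult_right[OF Q])
    finally show "(C * P) $$ (k, j) = (Q * mat_diag n f) $$ (k, j)" .
  qed (use C P Q in \<open>auto simp: mat_diag_def\<close>)
  then have "det C * det P = det Q * det (mat_diag n f)"
    using det_mult[OF C P] det_mult[OF Q mat_diag_dim[of n f]] by simp
  moreover have "det P = 1"
  proof -
    have "upper_triangular P" using J by (intro upper_triangularI) (auto simp: P_def)
    then have "det P = prod_list (diag_mat P)" using P by (rule det_upper_triangular)
    also have "\<dots> = 1" using P by (auto simp: prod_list_diag_prod P_def)
    finally show ?thesis .
  qed
  moreover have "det (mat_diag n f) = [:- lam, 1:] ^ card J"
  proof -
    have "det (mat_diag n f) = prod_list (diag_mat (mat_diag n f))"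
      by (rule det_upper_triangular[OF _ mat_diag_dim]) (auto simp: mat_diag_def)
    also have "\<dots> = (\<Prod>j = 0..<n. f j)"
      by (auto simp: prod_list_diag_prod mat_diag_def)
    also have "\<dots> = (\<Prod>j\<in>J. [:- lam, 1:])"
      unfolding f_def by (rule prod.mono_neutral_cong_right) (use J in auto)
    finally show ?thesis by simp
  qed
  ultimately have "char_poly A = det Q * [:- lam, 1:] ^ card J"
    by (simp add: C_def char_poly_def)
  then show ?thesis by simp
qed

section \<open>Distances to vertices with the same neighbours\<close>

context wf_digraph
begin

text \<open>
  The distance is a minimum over paths without repeated vertices; cutting the cycles out of
  a walk only shortens it, so arbitrary walks may be used for upper bounds.
\<close>

lemma gdist_le_awalk_length:
  assumes "awalk u p v"
  shows "gdist G u v \<le> length p"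
proof -
  have "length (awalk_to_apath p) \<le> length p"
    using assms
  proof (induct rule: awalk_to_apath_induct)
    case (path p)
    then show ?case by (auto simp: awalk_to_apath.simps)
  next
    case (decomp p q r s)
    then have "p = q @ r @ s" by (auto elim: awalk_cyc_decompE)
    then show ?case using decomp step_awalk_to_apath[of u p v q r s] by simp
  qed
  moreover have "gdist G u v \<le> length (awalk_to_apath p)"
    unfolding gdist_def using apath_awalk_to_apath[OF assms] by (intro Least_le) blast
  ultimately show ?thesis by simp
qed

lemma awalk_of_length_gdist:
  assumes "u \<rightarrow>\<^sup>*\<^bsub>G\<^esub> v"
  obtains p where "awalk u p v" "length p = gdist G u v"
proof -
  have "\<exists>k p. apath u p v \<and> length p = k" using assms reachable_apath by blast
  then have "\<exists>p. apath u p v \<and> length p = gdist G u v"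
    unfolding gdist_def by (rule LeastI_ex)
  then show ?thesis using that by (auto simp: apath_def)
qed

lemma gdist_self: "u \<in> verts G \<Longrightarrow> gdist G u u = 0"
  using gdist_le_awalk_length[of u "[]" u] by (simp add: awalk_Nil_iff)

lemma gdist_pos:
  assumes "u \<rightarrow>\<^sup>*\<^bsub>G\<^esub> v" "u \<noteq> v"
  shows "gdist G u v \<ge> 1"
  using assms(2) awalk_of_length_gdist[OF assms(1)]
  by (metis Suc_leI One_nat_def awalk_Nil_iff length_greater_0_conv)

lemma gdist_ge_2:
  assumes "u \<rightarrow>\<^sup>*\<^bsub>G\<^esub> v" "u \<noteq> v" "\<not> u \<rightarrow>\<^bsub>G\<^esub> v"
  shows "gdist G u v \<ge> 2"
proof (rule ccontr)
  assume "\<not> gdist G u v \<ge> 2"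
  then have 1: "gdist G u v = 1" using gdist_pos[OF assms(1,2)] by linarith
  obtain p where p: "awalk u p v" "length p = gdist G u v"
    using awalk_of_length_gdist[OF assms(1)] .
  then obtain e where "p = [e]" using 1 by (cases p) auto
  then show False using p(1) assms(3) by (auto simp: awalk_Cons_iff awalk_Nil_iff intro: in_arcs_imp_in_arcs_ends)
qed

text \<open>Redirect the last arc of a shortest walk to \<open>u\<close> so that it ends in \<open>v\<close>.\<close>

lemma gdist_mono_in_neighbours:
  assumes "w \<rightarrow>\<^sup>*\<^bsub>G\<^esub> u" "w \<noteq> u" and nb: "\<And>x. x \<rightarrow>\<^bsub>G\<^esub> u \<Longrightarrow> x \<rightarrow>\<^bsub>G\<^esub> v"
  shows "gdist G w v \<le> gdist G w u"
proof -
  obtain p where p: "awalk w p u" "length p = gdist G w u"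
    using awalk_of_length_gdist[OF assms(1)] .
  from p(1) \<open>w \<noteq> u\<close> have "p \<noteq> []" by (auto simp: awalk_Nil_iff)
  then obtain q e where pq: "p = q @ [e]" by (metis rev_exhaust)
  then have q: "awalk w q (tail G e)" "e \<in> arcs G" "head G e = u"
    using p(1) by (auto simp: awalk_Cons_iff awalk_Nil_iff)
  then have "tail G e \<rightarrow>\<^bsub>G\<^esub> v" using nb in_arcs_imp_in_arcs_ends by blast
  then obtain e' where "e' \<in> arcs G" "tail G e' = tail G e" "head G e' = v" by auto
  then have "awalk w (q @ [e']) v" using q(1) by (auto simp: awalk_Cons_iff awalk_Nil_iff)
  then show ?thesis using gdist_le_awalk_length[of w "q @ [e']" v] p(2) pq by simp
qed

lemma gdist_eq_in_neighbours:
  assumes "w \<rightarrow>\<^sup>*\<^bsub>G\<^esub> u" "w \<rightarrow>\<^sup>*\<^bsub>G\<^esub> v" "w \<noteq> u" "w \<noteq> v" "\<And>x. x \<rightarrow>\<^bsub>G\<^esub> u \<longleftrightarrow> x \<rightarrow>\<^bsub>G\<^esub> v"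
  shows "gdist G w u = gdist G w v"
  using gdist_mono_in_neighbours[of w u v] gdist_mono_in_neighbours[of w v u] assms
  by (meson antisym)

end

lemma (in sym_digraph) connected_reachable:
  assumes "Digraph_Component.connected G" "u \<in> verts G" "v \<in> verts G"
  shows "u \<rightarrow>\<^sup>*\<^bsub>G\<^esub> v"
  using assms reachable_mk_symmetric_eq[OF sym_arcs]
  by (auto simp: connected_def strongly_connected_def)

lemma dominates_iff_of_nbhd_eq:
  assumes "graph G" "nbhd G u = nbhd G v"
  shows "x \<rightarrow>\<^bsub>G\<^esub> u \<longleftrightarrow> x \<rightarrow>\<^bsub>G\<^esub> v"
proof -
  interpret graph G by fact
  show ?thesis using assms(2) adj_in_verts(1) unfolding nbhd_def by blast
qed

text \<open>
  A shortest walk between the two vertices has a last inner vertex, and this vertex is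
  a common neighbour.
\<close>

lemma gdist_twins:
  assumes "graph G" "Digraph_Component.connected G"
    and uv: "u \<in> verts G" "v \<in> verts G" "u \<noteq> v" "\<not> u \<rightarrow>\<^bsub>G\<^esub> v" "nbhd G u = nbhd G v"
  shows "gdist G u v = 2"
proof -
  interpret graph G by fact
  have r: "u \<rightarrow>\<^sup>*\<^bsub>G\<^esub> v" using connected_reachable assms by blast
  obtain p where p: "awalk u p v" using r reachable_awalk by blast
  from p uv(3) have "p \<noteq> []" by (auto simp: awalk_Nil_iff)
  then obtain q e where "p = q @ [e]" by (metis rev_exhaust)
  then have "e \<in> arcs G" "head G e = v" using p by (auto simp: awalk_Cons_iff awalk_Nil_iff)
  then have xv: "tail G e \<rightarrow>\<^bsub>G\<^esub> v" using in_arcs_imp_in_arcs_ends by blast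
  then have "tail G e \<rightarrow>\<^bsub>G\<^esub> u" using dominates_iff_of_nbhd_eq[OF assms(1) uv(5)] by blast
  then have "u \<rightarrow>\<^bsub>G\<^esub> tail G e" using arcs_ends_symmetric[OF sym_arcs] by blast
  then obtain d where "d \<in> arcs G" "tail G d = u" "head G d = tail G e" by auto
  then have "awalk u [d, e] v"
    using \<open>e \<in> arcs G\<close> \<open>head G e = v\<close> by (auto simp: awalk_Cons_iff awalk_Nil_iff)
  then have "gdist G u v \<le> 2" using gdist_le_awalk_length[of u "[d, e]" v] by simp
  then show ?thesis using gdist_ge_2[OF r uv(3,4)] by simp
qed

lemma transmission_twins:
  assumes "graph G" "Digraph_Component.connected G"
    and uv: "u \<in> verts G" "v \<in> verts G" "u \<noteq> v" "\<not> u \<rightarrow>\<^bsub>G\<^esub> v" "nbhd G u = nbhd G v"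
  shows "transmission G u = transmission G v"
proof -
  interpret graph G by fact
  have vu: "\<not> v \<rightarrow>\<^bsub>G\<^esub> u" using uv(4) arcs_ends_symmetric[OF sym_arcs] by blast
  have d: "gdist G u v = 2" "gdist G v u = 2"
    using gdist_twins[OF assms] gdist_twins[OF assms(1,2) uv(2,1) _ vu] uv by auto
  have split: "transmission G x = real (gdist G u x) + real (gdist G v x)
      + (\<Sum>w\<in>verts G - {u} - {v}. real (gdist G w x))" for x
  proof -
    have v: "v \<in> verts G - {u}" using uv by simp
    show ?thesis
      unfolding transmission_def sum.remove[OF finite_verts uv(1)]
        sum.remove[OF finite_Diff[OF finite_verts] v] by simp
  qed
  have "(\<Sum>w\<in>verts G - {u} - {v}. real (gdist G w u))
      = (\<Sum>w\<in>verts G - {u} - {v}. real (gdist G w v))"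
  proof (rule sum.cong[OF refl])
    fix w assume "w \<in> verts G - {u} - {v}"
    then have w: "w \<in> verts G" "w \<noteq> u" "w \<noteq> v" by simp_all
    note reach = connected_reachable[OF assms(2) w(1)]
    have "gdist G w u = gdist G w v"
      by (rule gdist_eq_in_neighbours[OF reach[OF uv(1)] reach[OF uv(2)] w(2,3)
            dominates_iff_of_nbhd_eq[OF assms(1) uv(5)]])
    then show "real (gdist G w u) = real (gdist G w v)" by simp
  qed
  then show ?thesis using d uv gdist_self by (simp add: split)
qed

lemma transmission_lower_bound:
  assumes "graph G" "Digraph_Component.connected G" "v \<in> verts G"
  shows "transmission G v \<ge> 2 * real (card (verts G)) - real (card (nbhd G v)) - 2"
proof -
  interpret graph G by fact
  have N: "nbhd G v \<subseteq> verts G - {v}"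
  proof
    fix x assume "x \<in> nbhd G v"
    then have x: "x \<in> verts G" "x \<rightarrow>\<^bsub>G\<^esub> v" by (simp_all add: nbhd_def)
    then have "x \<noteq> v" using adj_not_same[of v] by metis
    then show "x \<in> verts G - {v}" using x(1) by simp
  qed
  have "(\<Sum>u\<in>verts G - {v}. 2 - (if u \<in> nbhd G v then 1 else 0 :: real))
      \<le> (\<Sum>u\<in>verts G - {v}. real (gdist G u v))"
  proof (rule sum_mono)
    fix u assume u: "u \<in> verts G - {v}"
    then have r: "u \<rightarrow>\<^sup>*\<^bsub>G\<^esub> v" using connected_reachable assms by blast
    show "2 - (if u \<in> nbhd G v then 1 else 0 :: real) \<le> real (gdist G u v)"
      using gdist_pos[OF r] gdist_ge_2[OF r] u by (auto simp: nbhd_def)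
  qed
  moreover have "(\<Sum>u\<in>verts G - {v}. if u \<in> nbhd G v then 1 else 0 :: real) = card (nbhd G v)"
    using N by (simp add: sum.If_cases Int_absorb1)
  moreover have "transmission G v = (\<Sum>u\<in>verts G - {v}. real (gdist G u v))"
    unfolding transmission_def sum.remove[OF finite_verts assms(3)]
    by (simp add: gdist_self[OF assms(3)])
  moreover have "real (card (verts G - {v})) = real (card (verts G)) - 1"
    using card_Suc_Diff1[OF finite_verts assms(3)] by linarith
  ultimately show ?thesis by (simp add: sum_subtractf)
qed

section \<open>The eigenvalue of a set of twins\<close>

lemma dl_count_ge_count:
  assumes "b \<le> lam" "count (dl_eigenvalues G vs) lam > 0"
  shows "dl_count G vs {b .. dl_eigenvalue G vs 1} \<ge> count (dl_eigenvalues G vs) lam"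
proof -
  let ?E = "dl_eigenvalues G vs"
  let ?l = "sorted_list_of_multiset ?E"
  have mem: "lam \<in> set ?l" using assms(2) by simp
  then have "?l \<noteq> []" by (metis empty_iff list.set(1))
  then have "dl_eigenvalue G vs 1 = last ?l"
    by (simp add: dl_eigenvalue_def rev_nth last_conv_nth)
  moreover obtain m where "m < length ?l" "lam = ?l ! m"
    using mem by (metis in_set_conv_nth)
  then have "lam \<le> last ?l"
    using sorted_nth_mono[OF sorted_sorted_list_of_multiset, of m "length ?l - 1" ?E]
    by (simp add: last_conv_nth[OF \<open>?l \<noteq> []\<close>])
  ultimately have "lam \<in> {b .. dl_eigenvalue G vs 1}" using assms(1) by simp
  then have "count (filter_mset (\<lambda>x. x \<in> {b .. dl_eigenvalue G vs 1}) ?E) lam = count ?E lam"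
    by simp
  then show ?thesis unfolding dl_count_def by (metis count_le_size)
qed

theorem theorem4p2:
  fixes G :: "('a, 'b) pre_digraph" and vs :: "'a list"
    and n \<chi> s :: nat and b :: real and M N :: "'a set"
  assumes "graph G" and "Digraph_Component.connected G"
    and "distinct vs" and "set vs = verts G"
    and "n = card (verts G)" and "\<chi> = chromatic_number G"
    and "b = real n + of_int \<lceil>real n / real \<chi>\<rceil>"
    and "independent_set G M" and "card M = s" and "s \<ge> 2"
    and "N \<subseteq> verts G - M" and "\<forall>v\<in>M. nbhd G v = N"
  shows "\<exists>lam::real. (\<forall>v\<in>M. lam = transmission G v + 2) \<and>
           (eigenvalue (dist_laplacian G vs) lam \<and>
              count (dl_eigenvalues G vs) lam \<ge> s - 1) \<and>
           lam \<ge> 2 * real n - real (card N) \<and>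
           (int (card N) \<le> int n - \<lceil>real n / real \<chi>\<rceil> \<longrightarrow>
              lam \<ge> b \<and> dl_count G vs {b .. dl_eigenvalue G vs 1} \<ge> s - 1)"
proof -
  interpret graph G by fact
  have len: "length vs = n" using assms(3,4,5) distinct_card by metis
  have M: "M \<subseteq> verts G" "\<And>u v. u \<in> M \<Longrightarrow> v \<in> M \<Longrightarrow> \<not> u \<rightarrow>\<^bsub>G\<^esub> v"
    using assms(8) by (auto simp: independent_set_def)
  note conn = connected_reachable[OF assms(2)]
  have nb: "nbhd G u = nbhd G v" if "u \<in> M" "v \<in> M" for u v using that assms(12) by simp
  have tw: "gdist G u v = 2" "transmission G u = transmission G v"
    if "u \<in> M" "v \<in> M" "u \<noteq> v" for u v
    using gdist_twins[OF assms(1,2), of u v] transmission_twins[OF assms(1,2), of u v]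
      that M nb[OF that(1,2)] by auto
  define K where "K = {k. k < n \<and> vs ! k \<in> M}"
  have "bij_betw (\<lambda>k. vs ! k) K M"
  proof (rule bij_betwI')
    show "(vs ! x = vs ! y) = (x = y)" if "x \<in> K" "y \<in> K" for x y
      using that len assms(3) by (auto simp: K_def nth_eq_iff_index_eq)
    show "vs ! x \<in> M" if "x \<in> K" for x using that by (simp add: K_def)
    show "\<exists>x\<in>K. y = vs ! x" if "y \<in> M" for y
    proof -
      have "y \<in> set vs" using that M(1) assms(4) by blast
      then obtain x where "x < n" "vs ! x = y" using len by (auto simp: in_set_conv_nth)
      then show ?thesis using that by (auto simp: K_def)
    qed
  qed
  then have cK: "card K = s" using assms(9) bij_betw_same_card by metis
  have finK: "finite K" by (simp add: K_def)
  have "K \<noteq> {}" using cK assms(10) by auto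
  \<comment> \<open>The reference column is the leftmost one belonging to \<open>M\<close>, so that it precedes the others.\<close>
  define i where "i = Min K"
  define J where "J = K - {i}"
  have iK: "i \<in> K" using finK \<open>K \<noteq> {}\<close> by (simp add: i_def)
  have i: "i < n" "vs ! i \<in> M" using iK by (auto simp: K_def)
  have cJ: "card J = s - 1" using cK iK finK by (simp add: J_def)
  have J: "J \<subseteq> {i<..<n}"
    using finK by (auto simp: J_def K_def i_def order.strict_iff_order)
  define lam where "lam = transmission G (vs ! i) + 2"
  have lam: "lam = transmission G v + 2" if "v \<in> M" for v
    using tw(2)[OF that i(2)] by (cases "v = vs ! i") (auto simp: lam_def)
  let ?A = "dist_laplacian G vs"
  have A: "?A \<in> carrier_mat n n"
    using len by (auto simp: dist_laplacian_def dist_matrix_def mat_diag_def)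
  have Aent: "?A $$ (k, j) = (if k = j then transmission G (vs ! j) else 0) - gdist G (vs ! k) (vs ! j)"
    if "k < n" "j < n" for k j
    using that len by (auto simp: dist_laplacian_def dist_matrix_def mat_diag_def)
  have dvd: "[:- lam, 1:] ^ card J dvd char_poly ?A"
  proof (rule linear_power_dvd_char_poly[OF A i(1) J])
    fix j k assume j: "j \<in> J" and k: "k < n"
    have jn: "j < n" "vs ! j \<in> M" "j \<noteq> i" using j by (auto simp: J_def K_def)
    have neq: "vs ! j \<noteq> vs ! i" using jn i len assms(3) by (simp add: nth_eq_iff_index_eq)
    have inv: "vs ! k \<in> verts G" using k len assms(4) nth_mem by blast
    show "?A $$ (k, j) - ?A $$ (k, i) = (if k = j then lam else if k = i then - lam else 0)"
    proof -
      consider "k = j" | "k = i" "k \<noteq> j" | "k \<noteq> j" "k \<noteq> i" by blast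
      then show ?thesis
      proof cases
        case 1
        then show ?thesis
          using jn i tw(1)[OF jn(2) i(2) neq] gdist_self[OF inv] lam[OF jn(2)] by (simp add: Aent)
      next
        case 2
        then show ?thesis
          using jn i tw(1)[OF i(2) jn(2)] neq gdist_self[OF inv] by (simp add: Aent lam_def)
      next
        case 3
        then have "vs ! k \<noteq> vs ! j" "vs ! k \<noteq> vs ! i"
          using k jn i len assms(3) by (simp_all add: nth_eq_iff_index_eq)
        then have "gdist G (vs ! k) (vs ! j) = gdist G (vs ! k) (vs ! i)"
          using conn[OF inv] M(1) jn(2) i(2) dominates_iff_of_nbhd_eq[OF assms(1) nb[OF jn(2) i(2)]]
          by (intro gdist_eq_in_neighbours) blast+
        then show ?thesis using 3 k jn i by (simp add: Aent)
      qed
    qed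
  qed
  have nz: "char_poly ?A \<noteq> 0" using degree_monic_char_poly[OF A] by auto
  have cnt: "count (dl_eigenvalues G vs) lam \<ge> s - 1"
    using dvd nz cJ by (simp add: dl_eigenvalues_def order_divides)
  then have pos: "count (dl_eigenvalues G vs) lam > 0" using assms(10) by linarith
  then have "eigenvalue ?A lam"
    using nz by (simp add: eigenvalue_root_char_poly[OF A] dl_eigenvalues_def order_gt_0_iff)
  moreover have bound: "lam \<ge> 2 * real n - real (card N)"
    using transmission_lower_bound[OF assms(1,2), of "vs ! i"] i(2) M(1) assms(5,12)
    by (auto simp: lam_def)
  moreover have "lam \<ge> b" if "int (card N) \<le> int n - \<lceil>real n / real \<chi>\<rceil>"
    using that bound assms(7) by linarith
  ultimately show ?thesis
    using lam cnt dl_count_ge_count[OF _ pos, of b] by (intro exI[of _ lam]) (meson order_trans)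
qed

end
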